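(* Let $\Phi\subset\mathbb{R}^3$ be a skew ruled $C^3$-surface, parametrized by $\boldsymbol{x}(u,v)=\boldsymbol{s}(u)+v\,\boldsymbol{e}(u)$, $(u,v)\in I\times\mathbb{R}$, where $\boldsymbol{s}$ is the striction line, $\boldsymbol{e}$ is a unit vector field along the rulings and $u$ is the arclength of the spherical curve $\boldsymbol{e}$. Let $k$, $\delta$ be its conical curvature and parameter of distribution, and let $w=\sqrt{v^2+\delta(u)^2}$. Suppose that one of the principal curvatures $k_i$ ($i=1$ or $2$) of $\Phi$ has the form $$k_i(u,v)=f(u)\,w^{n}\quad\text{for all }(u,v)\in I\times\mathbb{R},$$ for some integer $n\in\mathbb{Z}$ and some continuous function $f:I\to\mathbb{R}$. Then one of the following occurs: (a) $n=-1$, $f(u)=-k(u)$ for all $u\in I$, and $\Phi$ is an Edlinger-surface; (b) $n=-2$, $f(u)=\pm\delta(u)$, and $\Phi$ is a right helicoid; (c) $n=-3$, $f(u)=\delta^2(u)\,k^{-1}(u)$ for all $u\in I$, and $\Phi$ is an Edlinger-surface.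
   Context: Setting. $I\subset\mathbb{R}$ is an open interval. A skew ruled $C^3$-surface $\Phi$ is a regular ruled surface of class $C^3$ without torsal rulings, parametrized on $I\times\mathbb{R}$ by $\boldsymbol{x}(u,v)=\boldsymbol{s}(u)+v\,\boldsymbol{e}(u)$ with $|\boldsymbol{e}|=1$, $|\boldsymbol{e}'|=1$ and $\langle\boldsymbol{s}',\boldsymbol{e}'\rangle=0$ on $I$ (so $\boldsymbol{s}$ is the striction line and $u$ is the arclength of $\boldsymbol{e}$); prime denotes $d/du$. Its invariants are: the conical curvature $k=(\boldsymbol{e},\boldsymbol{e}',\boldsymbol{e}'')$ and the parameter of distribution $\delta=(\boldsymbol{e},\boldsymbol{e}',\boldsymbol{s}')$ (both triple products), the striction $\sigma=\sphericalangle(\boldsymbol{e},\boldsymbol{s}')$ with $-\pi/2<\sigma\le\pi/2$ and $\operatorname{sign}\sigma=\operatorname{sign}\delta$, and $\lambda:=\cot\sigma$, so that $\boldsymbol{s}'=\delta\lambda\,\boldsymbol{e}+\delta\,\boldsymbol{e}\times\boldsymbol{e}'$. Skewness means $\delta(u)\neq0$ for all $u\in I$. The unit normal is $(\boldsymbol{x}_u\times\boldsymbol{x}_v)/|\boldsymbol{x}_u\times\boldsymbol{x}_v|$. With $u^1=u$, $u^2=v$, the first fundamental form is $g_{11}=v^2+\delta^2(\lambda^2+1)$, $g_{12}=\delta\lambda$, $g_{22}=1$; the second is $h_{11}=-\frac1w[k v^2+\delta' v+\delta^2(k-\lambda)]$, $h_{12}=\frac{\delta}{w}$, $h_{22}=0$.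 The Gaussian curvature is $K=-\delta^2/w^4<0$, so at each point there are two distinct principal curvatures $k_1,k_2$, of opposite sign, and they are continuous functions on $I\times\mathbb{R}$. An Edlinger-surface is a skew ruled surface whose osculating quadrics are rotational hyperboloids; a known necessary and sufficient condition, to be used as the definition, is $\delta'=0$ and $k\lambda+1=0$ on $I$. A right helicoid is characterized by $k=\lambda=\delta'=0$ on $I$. *)

theory Defs
  imports "HOL-Analysis.Analysis"
begin

definition vderiv :: "(real \<Rightarrow> 'a::real_normed_vector) \<Rightarrow> real \<Rightarrow> 'a" where
  "vderiv f = (\<lambda>t. vector_derivative f (at t))"

text \<open>Class \<open>C\<^sup>m\<close>; used for open \<open>I\<close> only, so two-sided derivatives are the right ones.\<close>

definition Cm_on :: "nat \<Rightarrow> (real \<Rightarrow> 'a::real_normed_vector) \<Rightarrow> real set \<Rightarrow> bool" where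
  "Cm_on m f I \<longleftrightarrow>
     (\<forall>j<m. \<forall>u\<in>I. ((vderiv ^^ j) f) differentiable (at u)) \<and> continuous_on I ((vderiv ^^ m) f)"

definition triple :: "real^3 \<Rightarrow> real^3 \<Rightarrow> real^3 \<Rightarrow> real" where
  "triple a b c = cross3 a b \<bullet> c"

definition conical_curvature :: "(real \<Rightarrow> real^3) \<Rightarrow> real \<Rightarrow> real" where
  "conical_curvature e u = triple (e u) (vderiv e u) (vderiv (vderiv e) u)"

definition distribution_parameter :: "(real \<Rightarrow> real^3) \<Rightarrow> (real \<Rightarrow> real^3) \<Rightarrow> real \<Rightarrow> real" where
  "distribution_parameter s e u = triple (e u) (vderiv e u) (vderiv s u)"

text \<open>
  The striction is the angle between \<open>e\<close> and \<open>s'\<close>, signed by the parameter of distribution.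
  It is not reduced modulo \<open>\<pi>\<close> to the interval from \<open>-\<pi>/2\<close> (excluded) to \<open>\<pi>/2\<close>: this reduction
  does not change the cotangent, the only quantity that is used, whereas the range and the
  sign rule cannot both be imposed when \<open>e \<bullet> s' < 0\<close>, nor when \<open>e \<bullet> s' = 0\<close> and the parameter
  of distribution is negative.
\<close>

definition striction :: "(real \<Rightarrow> real^3) \<Rightarrow> (real \<Rightarrow> real^3) \<Rightarrow> real \<Rightarrow> real" where
  "striction s e u = sgn (distribution_parameter s e u) *
     arccos ((e u \<bullet> vderiv s u) / (norm (e u) * norm (vderiv s u)))"

definition cot_striction :: "(real \<Rightarrow> real^3) \<Rightarrow> (real \<Rightarrow> real^3) \<Rightarrow> real \<Rightarrow> real" where
  "cot_striction s e u = cot (striction s e u)"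

text \<open>
  As \<open>x(u,v) = s(u) + v e(u)\<close>, with \<open>s = x(\<cdot>,0)\<close> and \<open>e = x(\<cdot>,1) - x(\<cdot>,0)\<close>, is affine in \<open>v\<close>, it is
  of class \<open>C\<^sup>3\<close> on \<open>I \<times> \<real>\<close> iff \<open>s\<close> and \<open>e\<close> are of class \<open>C\<^sup>3\<close> on \<open>I\<close>. The last condition says that
  there are no torsal rulings; it implies regularity, since the cross product of the partial
  derivatives of \<open>x\<close> has norm \<open>sqrt (v\<^sup>2 + \<delta>\<^sup>2)\<close>.
\<close>

definition skew_ruled_surface :: "real set \<Rightarrow> (real \<Rightarrow> real^3) \<Rightarrow> (real \<Rightarrow> real^3) \<Rightarrow> bool" where
  "skew_ruled_surface I s e \<longleftrightarrow>
     open I \<and> is_interval I \<and> I \<noteq> {} \<and>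
     Cm_on 3 s I \<and> Cm_on 3 e I \<and>
     (\<forall>u\<in>I. norm (e u) = 1 \<and> norm (vderiv e u) = 1 \<and> vderiv s u \<bullet> vderiv e u = 0) \<and>
     (\<forall>u\<in>I. distribution_parameter s e u \<noteq> 0)"

definition ruled_surface :: "(real \<Rightarrow> real^3) \<Rightarrow> (real \<Rightarrow> real^3) \<Rightarrow> real \<Rightarrow> real \<Rightarrow> real^3" where
  "ruled_surface s e = (\<lambda>u v. s u + v *\<^sub>R e u)"

definition w_fun :: "(real \<Rightarrow> real^3) \<Rightarrow> (real \<Rightarrow> real^3) \<Rightarrow> real \<Rightarrow> real \<Rightarrow> real" where
  "w_fun s e u v = sqrt (v\<^sup>2 + (distribution_parameter s e u)\<^sup>2)"

definition partial1 :: "(real \<Rightarrow> real \<Rightarrow> 'a::real_normed_vector) \<Rightarrow> real \<Rightarrow> real \<Rightarrow> 'a" where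
  "partial1 x = (\<lambda>u v. vderiv (\<lambda>t. x t v) u)"

definition partial2 :: "(real \<Rightarrow> real \<Rightarrow> 'a::real_normed_vector) \<Rightarrow> real \<Rightarrow> real \<Rightarrow> 'a" where
  "partial2 x = (\<lambda>u v. vderiv (\<lambda>t. x u t) v)"

definition unit_normal :: "(real \<Rightarrow> real \<Rightarrow> real^3) \<Rightarrow> real \<Rightarrow> real \<Rightarrow> real^3" where
  "unit_normal x u v =
     (let m = cross3 (partial1 x u v) (partial2 x u v) in m /\<^sub>R norm m)"

definition first_form :: "(real \<Rightarrow> real \<Rightarrow> real^3) \<Rightarrow> real \<Rightarrow> real \<Rightarrow> real^2^2" where
  "first_form x u v =
     vector [vector [partial1 x u v \<bullet> partial1 x u v, partial1 x u v \<bullet> partial2 x u v],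
             vector [partial2 x u v \<bullet> partial1 x u v, partial2 x u v \<bullet> partial2 x u v]]"

definition second_form :: "(real \<Rightarrow> real \<Rightarrow> real^3) \<Rightarrow> real \<Rightarrow> real \<Rightarrow> real^2^2" where
  "second_form x u v =
     vector [vector [partial1 (partial1 x) u v \<bullet> unit_normal x u v,
                     partial2 (partial1 x) u v \<bullet> unit_normal x u v],
             vector [partial1 (partial2 x) u v \<bullet> unit_normal x u v,
                     partial2 (partial2 x) u v \<bullet> unit_normal x u v]]"

text \<open>Eigenvalues of the shape operator, the inverse of the first form times the second form.\<close>

definition principal_curvature :: "(real \<Rightarrow> real \<Rightarrow> real^3) \<Rightarrow> real \<Rightarrow> real \<Rightarrow> real \<Rightarrow> bool" where
  "principal_curvature x u v \<kappa> \<longleftrightarrow>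
     (\<exists>a. a \<noteq> 0 \<and> second_form x u v *v a = \<kappa> *\<^sub>R (first_form x u v *v a))"

text \<open>
  The continuity makes each function a fixed branch where the two principal curvatures are
  distinct, as on a connected domain of negative Gaussian curvature.
\<close>

definition principal_curvature_functions ::
    "(real \<Rightarrow> real \<Rightarrow> real^3) \<Rightarrow> (real \<times> real) set \<Rightarrow>
     (real \<Rightarrow> real \<Rightarrow> real) \<Rightarrow> (real \<Rightarrow> real \<Rightarrow> real) \<Rightarrow> bool" where
  "principal_curvature_functions x D k\<^sub>1 k\<^sub>2 \<longleftrightarrow>
     continuous_on D (\<lambda>(u, v). k\<^sub>1 u v) \<and> continuous_on D (\<lambda>(u, v). k\<^sub>2 u v) \<and>
     (\<forall>(u, v)\<in>D. {\<kappa>. principal_curvature x u v \<kappa>} = {k\<^sub>1 u v, k\<^sub>2 u v})"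

text \<open>
  A skew ruled surface whose osculating quadrics are rotational hyperboloids, defined through
  the well-known condition on its invariants.
\<close>

definition Edlinger_surface :: "real set \<Rightarrow> (real \<Rightarrow> real^3) \<Rightarrow> (real \<Rightarrow> real^3) \<Rightarrow> bool" where
  "Edlinger_surface I s e \<longleftrightarrow> skew_ruled_surface I s e \<and>
     (\<forall>u\<in>I. deriv (distribution_parameter s e) u = 0 \<and>
            conical_curvature e u * cot_striction s e u + 1 = 0)"

text \<open>Likewise defined through the characterization by the invariants.\<close>

definition right_helicoid :: "real set \<Rightarrow> (real \<Rightarrow> real^3) \<Rightarrow> (real \<Rightarrow> real^3) \<Rightarrow> bool" where
  "right_helicoid I s e \<longleftrightarrow> skew_ruled_surface I s e \<and>
     (\<forall>u\<in>I. conical_curvature e u = 0 \<and> cot_striction s e u = 0 \<and>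
            deriv (distribution_parameter s e) u = 0)"

lemma striction_decomposition:
  assumes "skew_ruled_surface I s e" "u \<in> I"
  shows "vderiv s u =
      (distribution_parameter s e u * cot_striction s e u) *\<^sub>R e u +
      distribution_parameter s e u *\<^sub>R cross3 (e u) (vderiv e u)"
proof -
  define E where "E = e u"
  define F where "F = vderiv e u"
  define S where "S = vderiv s u"
  define c where "c = cross3 E F"
  define d where "d = distribution_parameter s e u"
  define a where "a = E \<bullet> S"
  have op: "open I" and C: "Cm_on 3 e I" and n1: "\<forall>t\<in>I. norm (e t) = 1"
    using assms unfolding skew_ruled_surface_def by auto
  have nE: "norm E = 1" and nF: "norm F = 1" and SF: "S \<bullet> F = 0" and d0: "d \<noteq> 0"
    using assms unfolding skew_ruled_surface_def E_def F_def S_def d_def by auto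
  have dS: "d = c \<bullet> S"
    unfolding d_def distribution_parameter_def triple_def c_def E_def F_def S_def ..
  have diff: "e differentiable (at u)"
    using C assms(2) unfolding Cm_on_def by (auto dest!: spec[of _ 0])
  then have D: "(e has_derivative (\<lambda>h. h *\<^sub>R F)) (at u)"
    unfolding F_def vderiv_def using vector_derivative_works has_vector_derivative_def by blast
  have "((\<lambda>t. e t \<bullet> e t) has_derivative (\<lambda>h. e u \<bullet> (h *\<^sub>R F) + (h *\<^sub>R F) \<bullet> e u)) (at u)"
    by (rule has_derivative_inner[OF D D])
  moreover have "((\<lambda>t. e t \<bullet> e t) has_derivative (\<lambda>h. 0)) (at u)"
  proof (rule has_derivative_transform_within_open[OF _ op assms(2)])
    show "((\<lambda>t. 1::real) has_derivative (\<lambda>h. 0)) (at u)" by simp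
    show "\<And>t. t \<in> I \<Longrightarrow> 1 = e t \<bullet> e t" using n1 by (simp add: norm_eq_1)
  qed
  ultimately have "(\<lambda>h. e u \<bullet> (h *\<^sub>R F) + (h *\<^sub>R F) \<bullet> e u) = (\<lambda>h. 0)"
    by (rule has_derivative_unique)
  then have EF: "E \<bullet> F = 0" unfolding E_def
    by (auto dest!: fun_cong[of _ _ 1] simp: inner_commute)
  have EE: "E \<bullet> E = 1" and FF: "F \<bullet> F = 1" using nE nF by (simp_all add: norm_eq_1)
  have cE: "c \<bullet> E = 0" and cF: "c \<bullet> F = 0" unfolding c_def by (simp_all add: dot_cross_self)
  have "(norm c)\<^sup>2 = 1"
    using norm_and_cross_eq_0 norm_cross_dot[of E F] nE nF EF unfolding c_def by simp
  then have cc: "c \<bullet> c = 1" by (simp add: dot_square_norm)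
  define y where "y = S - a *\<^sub>R E - d *\<^sub>R c"
  have yE: "y \<bullet> E = 0" and yF: "y \<bullet> F = 0" and yc: "y \<bullet> c = 0"
    unfolding y_def a_def dS using EE EF SF cE cF cc
    by (simp_all add: inner_diff_left inner_diff_right inner_commute)
  have "cross3 y c = 0"
    unfolding c_def using yE yF by (simp add: Lagrange)
  then have "y = 0"
    using norm_cross_dot[of y c] yc \<open>(norm c)\<^sup>2 = 1\<close> by (simp add: power_mult_distrib)
  then have Sdec: "S = a *\<^sub>R E + d *\<^sub>R c" unfolding y_def by (simp add: algebra_simps)
  have "S \<bullet> S = a\<^sup>2 + d\<^sup>2"
    unfolding Sdec using EE cE cc
    by (simp add: inner_add_left inner_add_right inner_commute power2_eq_square)
  then have N: "(norm S)\<^sup>2 = a\<^sup>2 + d\<^sup>2" by (simp add: dot_square_norm)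
  then have "(norm S)\<^sup>2 > 0" using d0 by (simp add: sum_power2_gt_zero_iff)
  then have Npos: "norm S > 0" by auto
  define q where "q = a / norm S"
  have q1: "1 - q\<^sup>2 = (d / norm S)\<^sup>2"
    unfolding q_def power_divide N using d0
    by (simp add: diff_eq_eq flip: add_divide_distrib)
  have "q\<^sup>2 \<le> 1" using q1 zero_le_power2[of "d / norm S"] by linarith
  then have q: "-1 \<le> q" "q \<le> 1" by (auto simp: abs_square_le_1 abs_le_iff)
  have si: "sin (arccos q) = \<bar>d\<bar> / norm S"
    unfolding sin_arccos[OF q] q1 by simp
  have "cot (sgn d * arccos q) = sgn d * cot (arccos q)"
    using d0 by (cases "d > 0") (auto simp: cot_def)
  also have "\<dots> = sgn d * (a / \<bar>d\<bar>)"
    unfolding cot_def si cos_arccos[OF q] using Npos d0 by (simp add: q_def)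
  also have "\<dots> = a / d" using d0 by (cases "d > 0") auto
  finally have "cot_striction s e u = a / d"
    unfolding cot_striction_def striction_def
    using nE by (simp add: q_def a_def E_def S_def d_def)
  then show ?thesis
    using Sdec d0 unfolding S_def d_def E_def F_def c_def by simp
qed

end

(*
  Let d be the parameter of distribution and l the cotangent of the striction. The
  characteristic equation of the shape operator at a principal curvature c is
    c^2 w^4 + c w (k v^2 + d' v + d^2 (k + l)) = d^2.
  For c = f w^n, comparing v with -v gives d' = 0, and v^2 = w^2 - d^2 leaves
    f^2 w^(2n+4) + f k w^(n+3) + f l d^2 w^(n+1) = d^2    for all w >= |d|.
  As f and d do not vanish, the exponents 2n+4 and 0 must each coincide with another
  exponent. This forces n = -1, -2 or -3, and the coefficients give the three cases.
*)
theory Submission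
  imports Defs
begin

section \<open>Differentiation of vector functions\<close>

lemma Cm_on_differentiable:
  assumes "Cm_on m f I" "j < m" "u \<in> I"
  shows "((vderiv ^^ j) f) differentiable (at u)"
  using assms unfolding Cm_on_def by blast

lemma differentiable_vderiv:
  "f differentiable (at u) \<Longrightarrow> (f has_vector_derivative vderiv f u) (at u)"
  unfolding vderiv_def using vector_derivative_works by blast

lemma vderiv_eqI: "(f has_vector_derivative D) (at u) \<Longrightarrow> vderiv f u = D"
  unfolding vderiv_def by (rule vector_derivative_at)

lemma has_vector_derivative_inner:
  fixes f g :: "real \<Rightarrow> 'a::real_inner"
  assumes "(f has_vector_derivative f') (at x)" "(g has_vector_derivative g') (at x)"
  shows "((\<lambda>t. f t \<bullet> g t) has_vector_derivative f x \<bullet> g' + f' \<bullet> g x) (at x)"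
  using has_derivative_inner[OF assms[unfolded has_vector_derivative_def]]
  by (simp add: has_vector_derivative_def algebra_simps)

text \<open>The product rule must give the derivative 0 of a function that is constant near
  \<open>x\<close>. Applied to the unit lengths and orthogonalities of \<open>e\<close>,
  \<open>e'\<close> and \<open>s'\<close>, it supplies the differential relations of the moving
  frame.\<close>

lemma constant_inner_derivative:
  fixes f g :: "real \<Rightarrow> 'a::real_inner"
  assumes "(f has_vector_derivative f') (at x)" "(g has_vector_derivative g') (at x)"
    and "open S" "x \<in> S" "\<And>t. t \<in> S \<Longrightarrow> f t \<bullet> g t = c"
  shows "f x \<bullet> g' + f' \<bullet> g x = 0"
proof -
  have "((\<lambda>t. f t \<bullet> g t) has_vector_derivative 0) (at x)"
    by (rule has_vector_derivative_transform_within_open[OF _ assms(3,4)])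
      (auto simp: assms(5))
  with has_vector_derivative_inner[OF assms(1,2)] show ?thesis
    by (rule vector_derivative_unique_at)
qed

lemma bounded_bilinear_cross3: "bounded_bilinear cross3"
  using bilinear_cross bilinear_conv_bounded_bilinear by blast

section \<open>Derivatives and moving frame of a skew ruled surface\<close>

lemma skew_ruled_surface_derivatives:
  assumes "skew_ruled_surface I s e" "u \<in> I"
  shows "(s has_vector_derivative vderiv s u) (at u)"
    and "(vderiv s has_vector_derivative vderiv (vderiv s) u) (at u)"
    and "(e has_vector_derivative vderiv e u) (at u)"
    and "(vderiv e has_vector_derivative vderiv (vderiv e) u) (at u)"
proof -
  have C: "Cm_on 3 s I" "Cm_on 3 e I"
    using assms(1) unfolding skew_ruled_surface_def by auto
  show "(s has_vector_derivative vderiv s u) (at u)"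
    "(vderiv s has_vector_derivative vderiv (vderiv s) u) (at u)"
    "(e has_vector_derivative vderiv e u) (at u)"
    "(vderiv e has_vector_derivative vderiv (vderiv e) u) (at u)"
    using Cm_on_differentiable[OF C(1) _ assms(2), of 0] Cm_on_differentiable[OF C(1) _ assms(2), of 1]
      Cm_on_differentiable[OF C(2) _ assms(2), of 0] Cm_on_differentiable[OF C(2) _ assms(2), of 1]
    by (auto intro: differentiable_vderiv)
qed

text \<open>Of the three terms of the product rule for a triple product, the one with
  \<open>cross3\<close> of \<open>vderiv e u\<close> with itself vanishes. Besides the value of the
  derivative, this yields the continuity of the parameter of distribution.\<close>

lemma distribution_parameter_has_derivative:
  assumes "skew_ruled_surface I s e" "u \<in> I"
  shows "(distribution_parameter s e has_vector_derivative
      cross3 (e u) (vderiv e u) \<bullet> vderiv (vderiv s) u +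
      cross3 (e u) (vderiv (vderiv e) u) \<bullet> vderiv s u) (at u)"
proof -
  note D = skew_ruled_surface_derivatives[OF assms]
  show ?thesis
    using has_vector_derivative_inner[OF
        bounded_bilinear.has_vector_derivative[OF bounded_bilinear_cross3 D(3,4)] D(2)]
    by (simp add: distribution_parameter_def[abs_def] triple_def)
qed

text \<open>These are the products that enter the two fundamental forms. They come from
  differentiating constant inner products and from expanding \<open>S\<close> in the orthonormal
  frame \<open>E\<close>, \<open>F\<close>, \<open>cross3 E F\<close>.\<close>

lemma skew_ruled_surface_frame:
  assumes "skew_ruled_surface I s e" "u \<in> I"
  defines "E \<equiv> e u" and "F \<equiv> vderiv e u" and "G \<equiv> vderiv (vderiv e) u"
    and "S \<equiv> vderiv s u" and "T \<equiv> vderiv (vderiv s) u"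
    and "k \<equiv> conical_curvature e u" and "d \<equiv> distribution_parameter s e u"
    and "l \<equiv> cot_striction s e u"
  shows "E \<bullet> E = 1" "F \<bullet> F = 1" "E \<bullet> F = 0" "S \<bullet> F = 0" "S \<bullet> E = d * l"
    "S \<bullet> S = d\<^sup>2 * l\<^sup>2 + d\<^sup>2" "cross3 E F \<bullet> S = d" "cross3 E F \<bullet> G = k" "G \<bullet> F = 0"
    "T \<bullet> F = d * l - d * k" "cross3 E F \<bullet> T = deriv (distribution_parameter s e) u"
proof -
  have op: "open I" and n: "\<And>t. t \<in> I \<Longrightarrow> norm (e t) = 1" "\<And>t. t \<in> I \<Longrightarrow> norm (vderiv e t) = 1"
    and SF: "\<And>t. t \<in> I \<Longrightarrow> vderiv s t \<bullet> vderiv e t = 0"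
    using assms(1) unfolding skew_ruled_surface_def by auto
  note D = skew_ruled_surface_derivatives[OF assms(1)]
  have ef: "e t \<bullet> vderiv e t = 0" if "t \<in> I" for t
    using constant_inner_derivative[OF D(3)[OF that] D(3)[OF that] op that, of 1] n
    by (simp add: norm_eq_1 inner_commute)
  show EE: "E \<bullet> E = 1" and FF: "F \<bullet> F = 1" and EF: "E \<bullet> F = 0" and SF': "S \<bullet> F = 0"
    using n ef SF assms(2) unfolding E_def F_def S_def by (auto simp: norm_eq_1)
  have EG: "E \<bullet> G = -1"
    using constant_inner_derivative[OF D(3)[OF assms(2)] D(4)[OF assms(2)] op assms(2), of 0] ef FF
    unfolding E_def F_def G_def by simp
  show GF: "G \<bullet> F = 0"
    using constant_inner_derivative[OF D(4)[OF assms(2)] D(4)[OF assms(2)] op assms(2), of 1] n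
    unfolding F_def G_def by (simp add: norm_eq_1 inner_commute)
  \<comment> \<open>Differentiating the striction condition trades \<open>T \<bullet> F\<close> for
    \<open>S \<bullet> G\<close>, which the expansion of \<open>S\<close> determines.\<close>
  have TF: "S \<bullet> G + T \<bullet> F = 0"
    using constant_inner_derivative[OF D(2)[OF assms(2)] D(4)[OF assms(2)] op assms(2), of 0] SF
    unfolding S_def F_def G_def T_def by simp
  show kG: "cross3 E F \<bullet> G = k"
    by (simp add: E_def F_def G_def k_def conical_curvature_def triple_def)
  show "cross3 E F \<bullet> S = d"
    by (simp add: E_def F_def S_def d_def distribution_parameter_def triple_def)
  have S: "S = (d * l) *\<^sub>R E + d *\<^sub>R cross3 E F"
    unfolding S_def d_def l_def E_def F_def by (rule striction_decomposition[OF assms(1,2)])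
  have CE: "cross3 E F \<bullet> E = 0" "E \<bullet> cross3 E F = 0"
    by (simp_all add: dot_cross_self)
  have CC: "cross3 E F \<bullet> cross3 E F = 1"
    using EE FF EF by (simp add: dot_cross inner_commute)
  show "S \<bullet> E = d * l"
    using EE CE by (simp add: S inner_simps)
  show "S \<bullet> S = d\<^sup>2 * l\<^sup>2 + d\<^sup>2"
    using EE CE CC by (simp add: S inner_simps power2_eq_square algebra_simps)
  have "S \<bullet> G = - d * l + d * k"
    using EG kG by (simp add: S inner_simps)
  with TF show "T \<bullet> F = d * l - d * k"
    by simp
  \<comment> \<open>\<open>S\<close> is a combination of \<open>E\<close> and
    \<open>cross3 E F\<close>; \<open>cross3 E G\<close> is orthogonal to the first, and to the
    second because \<open>G \<bullet> F = E \<bullet> F = 0\<close>. So only the term with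
    \<open>T\<close> survives in the derivative of the parameter of distribution.\<close>
  have "cross3 E G \<bullet> S = 0"
    using EE EF GF
    by (simp add: S inner_simps dot_cross dot_cross_self inner_commute)
  then show "cross3 E F \<bullet> T = deriv (distribution_parameter s e) u"
    using distribution_parameter_has_derivative[OF assms(1,2)]
    by (simp add: E_def F_def G_def S_def T_def DERIV_imp_deriv
        has_real_derivative_iff_has_vector_derivative)
qed

section \<open>Fundamental forms and principal curvatures\<close>

lemma ruled_surface_partials:
  assumes "skew_ruled_surface I s e" "u \<in> I"
  shows "partial1 (ruled_surface s e) u v = vderiv s u + v *\<^sub>R vderiv e u"
    and "partial2 (ruled_surface s e) u v = e u"
    and "partial1 (partial1 (ruled_surface s e)) u v =
      vderiv (vderiv s) u + v *\<^sub>R vderiv (vderiv e) u"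
    and "partial2 (partial1 (ruled_surface s e)) u v = vderiv e u"
    and "partial1 (partial2 (ruled_surface s e)) u v = vderiv e u"
    and "partial2 (partial2 (ruled_surface s e)) u v = 0"
proof -
  have op: "open I" using assms(1) unfolding skew_ruled_surface_def by auto
  note D = skew_ruled_surface_derivatives[OF assms(1)]
  have affine: "((\<lambda>t. f t + v *\<^sub>R g t) has_vector_derivative f' + v *\<^sub>R g') (at t)"
    if "(f has_vector_derivative f') (at t)" "(g has_vector_derivative g') (at t)"
    for f g :: "real \<Rightarrow> real^3" and f' g' v t
    using that by (auto intro!: derivative_eq_intros)
  have line: "((\<lambda>t. a + t *\<^sub>R b) has_vector_derivative b) (at t)" for a b :: "real^3" and t
    by (auto intro!: derivative_eq_intros)
  have p1: "partial1 (ruled_surface s e) t v = vderiv s t + v *\<^sub>R vderiv e t" if "t \<in> I" for t v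
    unfolding partial1_def ruled_surface_def
    by (rule vderiv_eqI, rule affine) (use D that in auto)
  have p2: "partial2 (ruled_surface s e) = (\<lambda>u v. e u)"
    unfolding partial2_def ruled_surface_def by (intro ext vderiv_eqI line)
  show "partial1 (ruled_surface s e) u v = vderiv s u + v *\<^sub>R vderiv e u"
    using p1 assms(2) by simp
  show "partial2 (ruled_surface s e) u v = e u"
    by (simp add: p2)
  \<comment> \<open>The formula \<open>p1\<close> is known only on \<open>I\<close>; openness of
    \<open>I\<close> allows differentiating it at \<open>u\<close>.\<close>
  have "((\<lambda>t. partial1 (ruled_surface s e) t v) has_vector_derivative
      vderiv (vderiv s) u + v *\<^sub>R vderiv (vderiv e) u) (at u)"
    by (rule has_vector_derivative_transform_within_open
        [OF affine[OF D(2)[OF assms(2)] D(4)[OF assms(2)]] op assms(2)]) (simp add: p1)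
  then show "partial1 (partial1 (ruled_surface s e)) u v =
      vderiv (vderiv s) u + v *\<^sub>R vderiv (vderiv e) u"
    unfolding partial1_def[of "partial1 _"] by (rule vderiv_eqI)
  show "partial2 (partial1 (ruled_surface s e)) u v = vderiv e u"
    unfolding partial2_def p1[OF assms(2)] by (intro vderiv_eqI line)
  show "partial1 (partial2 (ruled_surface s e)) u v = vderiv e u"
    unfolding p2 by (simp add: partial1_def)
  show "partial2 (partial2 (ruled_surface s e)) u v = 0"
    unfolding p2 by (simp add: partial2_def vderiv_def)
qed

text \<open>Cramer's rule without division: the determinant times either component of the kernel
  vector is a combination of the two equations.\<close>

lemma singular_2x2:
  fixes p q r t x y :: real
  assumes "p * x + q * y = 0" "r * x + t * y = 0" "x \<noteq> 0 \<or> y \<noteq> 0"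
  shows "p * t = q * r"
proof -
  have "(p * t - q * r) * x = t * (p * x + q * y) - q * (r * x + t * y)"
    and "(p * t - q * r) * y = p * (r * x + t * y) - r * (p * x + q * y)"
    by (simp_all add: algebra_simps)
  with assms show ?thesis by auto
qed

text \<open>The eigenvector lies in the kernel of the second form minus \<open>c\<close> times the
  first form, so the determinant of this matrix vanishes. In this form no inverse of the first form
  has to be computed.\<close>

lemma principal_curvature_characteristic_equation:
  assumes "principal_curvature x u v c"
  shows "(second_form x u v $ 1 $ 1 - c * first_form x u v $ 1 $ 1) *
      (second_form x u v $ 2 $ 2 - c * first_form x u v $ 2 $ 2) =
      (second_form x u v $ 1 $ 2 - c * first_form x u v $ 1 $ 2) *
      (second_form x u v $ 2 $ 1 - c * first_form x u v $ 2 $ 1)"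
proof -
  obtain a where a: "a \<noteq> 0" "second_form x u v *v a = c *\<^sub>R (first_form x u v *v a)"
    using assms unfolding principal_curvature_def by blast
  have "(second_form x u v *v a) $ i = (c *\<^sub>R (first_form x u v *v a)) $ i" for i
    using a(2) by simp
  from this[of 1] this[of 2] show ?thesis
    using a(1)
    by (intro singular_2x2[of _ "a $ 1" _ "a $ 2"])
      (auto simp: matrix_vector_mult_def sum_2 algebra_simps vec_eq_iff forall_2)
qed

text \<open>This is the vanishing determinant multiplied by \<open>w\<^sup>2\<close>. The terms
  \<open>c\<^sup>2 * d\<^sup>2 * l\<^sup>2\<close> on both sides cancel, and the mixed term of the
  squared off-diagonal entry turns the \<open>k - l\<close> of the second form into
  \<open>k + l\<close>.\<close>

lemma principal_curvature_ruled_surface: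
  assumes "skew_ruled_surface I s e" "u \<in> I" "principal_curvature (ruled_surface s e) u v c"
  defines "k \<equiv> conical_curvature e u" and "d \<equiv> distribution_parameter s e u"
    and "l \<equiv> cot_striction s e u" and "d' \<equiv> deriv (distribution_parameter s e) u"
    and "w \<equiv> w_fun s e u v"
  shows "c\<^sup>2 * w ^ 4 + c * w * (k * v\<^sup>2 + d' * v + d\<^sup>2 * (k + l)) = d\<^sup>2"
proof -
  define E F C S where "E = e u" and "F = vderiv e u" and "C = cross3 E F" and "S = vderiv s u"
  note fr = skew_ruled_surface_frame[OF assms(1,2), folded k_def d_def l_def d'_def E_def F_def,
      folded C_def S_def]
  note pa = ruled_surface_partials[OF assms(1,2), folded E_def F_def S_def]
  have d0: "d \<noteq> 0"
    using assms(1,2) unfolding skew_ruled_surface_def d_def by auto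
  have w2: "w\<^sup>2 = v\<^sup>2 + d\<^sup>2" and w0: "w > 0"
    using d0 unfolding w_def w_fun_def d_def[symmetric]
    by (auto simp: sum_power2_gt_zero_iff)
  have S: "S = (d * l) *\<^sub>R E + d *\<^sub>R C"
    unfolding S_def d_def l_def E_def F_def C_def by (rule striction_decomposition[OF assms(1,2)])
  \<comment> \<open>\<open>E\<close>, \<open>F\<close>, \<open>C\<close> is a positively oriented
    orthonormal frame. In the normal vector below the \<open>E\<close> part of \<open>S\<close>
    drops out, and \<open>cross3 F E\<close> contributes \<open>- C\<close>.\<close>
  have CE: "cross3 C E = F"
    using fr by (simp add: C_def Lagrange cross_skew[of "cross3 E F"] inner_commute)
  have m: "cross3 (S + v *\<^sub>R F) E = d *\<^sub>R F - v *\<^sub>R C"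
    by (simp add: S cross_add_left cross_mult_left CE cross_skew[of F E] flip: C_def)
  have CF: "C \<bullet> F = 0" "C \<bullet> E = 0"
    by (simp_all add: C_def dot_cross_self)
  have "C \<bullet> C = 1"
    using fr by (simp add: C_def dot_cross inner_commute)
  then have "(norm (d *\<^sub>R F - v *\<^sub>R C))\<^sup>2 = w\<^sup>2"
    using fr(2) CF unfolding power2_norm_eq_inner w2
    by (simp add: inner_simps inner_commute power2_eq_square)
  then have nm: "norm (d *\<^sub>R F - v *\<^sub>R C) = w"
    using w0 by (simp add: power2_eq_iff_nonneg)
  have N: "unit_normal (ruled_surface s e) u v = (d *\<^sub>R F - v *\<^sub>R C) /\<^sub>R w"
    unfolding unit_normal_def Let_def pa m nm ..
  have g: "first_form (ruled_surface s e) u v $ 1 $ 1 = v\<^sup>2 + d\<^sup>2 * l\<^sup>2 + d\<^sup>2"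
    "first_form (ruled_surface s e) u v $ 1 $ 2 = d * l"
    "first_form (ruled_surface s e) u v $ 2 $ 1 = d * l"
    "first_form (ruled_surface s e) u v $ 2 $ 2 = 1"
    using fr unfolding first_form_def pa
    by (simp_all add: inner_simps inner_commute power2_eq_square)
  have "(vderiv (vderiv s) u + v *\<^sub>R vderiv (vderiv e) u) \<bullet> (d *\<^sub>R F - v *\<^sub>R C) =
      d * (vderiv (vderiv s) u \<bullet> F) + v * d * (vderiv (vderiv e) u \<bullet> F)
      - v * (C \<bullet> vderiv (vderiv s) u) - v\<^sup>2 * (C \<bullet> vderiv (vderiv e) u)"
    by (simp add: inner_simps inner_commute power2_eq_square algebra_simps)
  also have "\<dots> = - (k * v\<^sup>2 + d' * v + d\<^sup>2 * (k - l))"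
    unfolding fr by (simp add: power2_eq_square algebra_simps)
  finally have h11: "(vderiv (vderiv s) u + v *\<^sub>R vderiv (vderiv e) u) \<bullet>
      (d *\<^sub>R F - v *\<^sub>R C) = - (k * v\<^sup>2 + d' * v + d\<^sup>2 * (k - l))" .
  have h: "second_form (ruled_surface s e) u v $ 1 $ 1 =
      - (k * v\<^sup>2 + d' * v + d\<^sup>2 * (k - l)) / w"
    "second_form (ruled_surface s e) u v $ 1 $ 2 = d / w"
    "second_form (ruled_surface s e) u v $ 2 $ 1 = d / w"
    "second_form (ruled_surface s e) u v $ 2 $ 2 = 0"
    using fr(2) CF unfolding second_form_def pa N inner_scaleR_right h11
    by (simp_all add: inner_diff_right inner_commute divide_inverse_commute)
  define P where "P = k * v\<^sup>2 + d' * v + d\<^sup>2 * (k - l)"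
  have "(- P / w - c * (w\<^sup>2 + d\<^sup>2 * l\<^sup>2)) * (- c) = (d / w - c * (d * l))\<^sup>2"
    using principal_curvature_characteristic_equation[OF assms(3)]
    unfolding g h w2 P_def by (simp add: power2_eq_square algebra_simps)
  \<comment> \<open>These relations let \<open>algebra\<close> clear the denominators of the
    determinant equation.\<close>
  moreover have "- P / w * w = - P" "d / w * w = d"
    using w0 by simp_all
  ultimately have "c\<^sup>2 * w ^ 4 + c * w * (P + 2 * d\<^sup>2 * l) = d\<^sup>2"
    by algebra
  then show ?thesis
    unfolding P_def by (simp add: algebra_simps)
qed

section \<open>Comparison of powers of \<open>w\<close>\<close>

text \<open>Let \<open>w\<close> tend to infinity. The successors keep the exponents of
  \<open>inverse w\<close> positive, so that every term but \<open>A\<close> tends to 0, whatever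
  the order of the exponents.\<close>

lemma leading_coefficient_eq_0:
  fixes A B C D r :: real
  assumes "\<And>w. w \<ge> r \<Longrightarrow> w > 0 \<Longrightarrow>
    A + B * inverse w ^ Suc i + C * inverse w ^ Suc j + D * inverse w ^ Suc l = 0"
  shows "A = 0"
proof -
  have "((\<lambda>w. A + B * inverse w ^ Suc i + C * inverse w ^ Suc j + D * inverse w ^ Suc l)
      \<longlongrightarrow> A + B * 0 ^ Suc i + C * 0 ^ Suc j + D * 0 ^ Suc l) at_top"
    by (intro tendsto_intros tendsto_inverse_0_at_top filterlim_ident)
  moreover have "\<forall>\<^sub>F w in at_top.
      A + B * inverse w ^ Suc i + C * inverse w ^ Suc j + D * inverse w ^ Suc l = 0"
    using eventually_ge_at_top[of r] eventually_gt_at_top[of 0]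
    by eventually_elim (rule assms)
  ultimately have "((\<lambda>w. 0) \<longlongrightarrow> A + B * 0 ^ Suc i + C * 0 ^ Suc j + D * 0 ^ Suc l)
      (at_top :: real filter)"
    by (rule Lim_transform_eventually)
  then show ?thesis
    by (simp add: tendsto_const_iff)
qed

text \<open>Two sample points \<open>p\<close> and \<open>2 * p\<close> separate the coefficients.
  This serves \<open>n = -1\<close> and \<open>n = -3\<close>, where only two powers of
  \<open>w\<close> remain and they differ by 2.\<close>

lemma affine_in_square_eq_0:
  fixes A B r :: real
  assumes "\<And>w. w \<ge> r \<Longrightarrow> w > 0 \<Longrightarrow> A * w\<^sup>2 + B = 0"
  shows "A = 0" "B = 0"
proof -
  define p where "p = max r 1"
  have "A * p\<^sup>2 + B = 0" "A * (2 * p)\<^sup>2 + B = 0" "p > 0"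
    using assms[of p] assms[of "2 * p"] by (auto simp: p_def)
  moreover have "A * (2 * p)\<^sup>2 = 4 * (A * p\<^sup>2)"
    by (simp add: power_mult_distrib)
  ultimately have "A * p\<^sup>2 = 0"
    by linarith
  with \<open>p > 0\<close> show "A = 0"
    by simp
  with \<open>A * p\<^sup>2 + B = 0\<close> show "B = 0"
    by simp
qed

lemma characteristic_equation_in_w:
  fixes f k d l d' :: real and n :: int
  assumes d0: "d \<noteq> 0"
    and eq: "\<And>v. (f * sqrt (v\<^sup>2 + d\<^sup>2) powi n)\<^sup>2 * sqrt (v\<^sup>2 + d\<^sup>2) ^ 4 +
      f * sqrt (v\<^sup>2 + d\<^sup>2) powi n * sqrt (v\<^sup>2 + d\<^sup>2) *
        (k * v\<^sup>2 + d' * v + d\<^sup>2 * (k + l)) = d\<^sup>2"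
  shows "d' = 0" and "f \<noteq> 0"
    and "w \<ge> \<bar>d\<bar> \<Longrightarrow> w > 0 \<Longrightarrow>
      f\<^sup>2 * (w powi n)\<^sup>2 * w ^ 4 + f * k * w powi n * w ^ 3 + f * l * d\<^sup>2 * w powi n * w = d\<^sup>2"
proof -
  \<comment> \<open>With \<open>f = 0\<close> the equation would read
    \<open>0 = d\<^sup>2\<close>.\<close>
  show f0: "f \<noteq> 0"
    using eq[of 0] d0 by auto
  \<comment> \<open>\<open>q\<close> is the common value of \<open>w\<close> at \<open>v = 1\<close>
    and \<open>v = -1\<close>; only the term with \<open>d'\<close> is odd in \<open>v\<close>, so
    it alone survives in the difference of the two equations.\<close>
  define q where "q = sqrt (1\<^sup>2 + d\<^sup>2)"
  have "q > 0" unfolding q_def by (simp add: add_pos_nonneg)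
  then have "f * q powi n * q \<noteq> 0" using f0 by simp
  moreover have "f * q powi n * q * d' = 0"
    using eq[of 1] eq[of "-1"] by (simp add: q_def[simplified] algebra_simps)
  ultimately show d': "d' = 0" by simp
  show "f\<^sup>2 * (w powi n)\<^sup>2 * w ^ 4 + f * k * w powi n * w ^ 3 + f * l * d\<^sup>2 * w powi n * w = d\<^sup>2"
    if w: "w \<ge> \<bar>d\<bar>" "w > 0"
  proof -
    \<comment> \<open>This \<open>v\<close> realizes the prescribed value of \<open>w\<close>, which
      is possible exactly because \<open>w\<close> is at least \<open>\<bar>d\<bar>\<close>.\<close>
    define v where "v = sqrt (w\<^sup>2 - d\<^sup>2)"
    have "d\<^sup>2 \<le> w\<^sup>2" using w by (simp add: abs_le_square_iff[symmetric])
    then have v2: "v\<^sup>2 = w\<^sup>2 - d\<^sup>2" unfolding v_def by simp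
    then have "sqrt (v\<^sup>2 + d\<^sup>2) = w" using w by simp
    with eq[of v] show ?thesis
      unfolding d' v2 by (simp add: power_mult_distrib power3_eq_cube power2_eq_square algebra_simps)
  qed
qed

text \<open>Here \<open>u\<close> is fixed and the invariants are mere numbers. The extreme ranges
  of \<open>n\<close> are excluded by a limit, the three remaining values are settled by sample
  points.\<close>

lemma characteristic_equation_power_solutions:
  fixes f k d l d' :: real and n :: int
  assumes d0: "d \<noteq> 0"
    and eq: "\<And>v. (f * sqrt (v\<^sup>2 + d\<^sup>2) powi n)\<^sup>2 * sqrt (v\<^sup>2 + d\<^sup>2) ^ 4 +
      f * sqrt (v\<^sup>2 + d\<^sup>2) powi n * sqrt (v\<^sup>2 + d\<^sup>2) *
        (k * v\<^sup>2 + d' * v + d\<^sup>2 * (k + l)) = d\<^sup>2"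
  shows "d' = 0 \<and>
    (n = -1 \<and> f = - k \<and> k * l + 1 = 0 \<or>
     n = -2 \<and> k = 0 \<and> l = 0 \<and> f\<^sup>2 = d\<^sup>2 \<or>
     n = -3 \<and> f = d\<^sup>2 * inverse k \<and> k * l + 1 = 0)"
proof -
  note d' = characteristic_equation_in_w(1)[OF d0 eq]
    and f0 = characteristic_equation_in_w(2)[OF d0 eq]
    and W = characteristic_equation_in_w(3)[OF d0 eq]
  consider "n \<ge> 0" | "n = -1" | "n = -2" | "n = -3" | "n \<le> -4" by linarith
  then show ?thesis
  proof cases
    case 1
    define m where "m = nat n"
    have n: "w powi n = w ^ m" for w :: real
      using 1 by (simp add: m_def power_int_def)
    \<comment> \<open>The highest power is \<open>w ^ (2 * m + 4)\<close>, from the term with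
      \<open>f\<^sup>2\<close>; divide by it.\<close>
    have "f\<^sup>2 = 0"
    proof (rule leading_coefficient_eq_0[of "\<bar>d\<bar>"])
      fix w :: real assume w: "w \<ge> \<bar>d\<bar>" "w > 0"
      show "f\<^sup>2 + f * k * inverse w ^ Suc m + f * l * d\<^sup>2 * inverse w ^ Suc (m + 2)
          + (- d\<^sup>2) * inverse w ^ Suc (2 * m + 3) = 0" (is "?L = 0")
      proof -
        have "?L = (f\<^sup>2 * (w ^ m)\<^sup>2 * w ^ 4 + f * k * w ^ m * w ^ 3 + f * l * d\<^sup>2 * w ^ m * w
            - d\<^sup>2) * inverse w ^ (2 * m + 4)"
          using w(2) by (simp add: field_simps power_add power_mult eval_nat_numeral)
        then show ?thesis using W[OF w] unfolding n by simp
      qed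
    qed
    with f0 show ?thesis by simp
  next
    case 5
    \<comment> \<open>Now \<open>n = - (m + 4)\<close>, and the exponents \<open>2n+4\<close>,
      \<open>n+3\<close>, \<open>n+1\<close> are all negative: the constant \<open>d\<^sup>2\<close>
      is the leading term.\<close>
    define m where "m = nat (- 4 - n)"
    have "nat (- n) = m + 4" using 5 unfolding m_def by linarith
    then have n: "w powi n = inverse w ^ (m + 4)" for w :: real
      using 5 by (simp add: power_int_def)
    have "d\<^sup>2 = 0"
    proof (rule leading_coefficient_eq_0[of "\<bar>d\<bar>"])
      fix w :: real assume w: "w \<ge> \<bar>d\<bar>" "w > 0"
      show "d\<^sup>2 + (- f * k) * inverse w ^ Suc m + (- f * l * d\<^sup>2) * inverse w ^ Suc (m + 2)
          + (- f\<^sup>2) * inverse w ^ Suc (2 * m + 3) = 0"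
      proof -
        have "w powi n * w = inverse w ^ Suc (m + 2)" "w powi n * w ^ 3 = inverse w ^ Suc m"
          "(w powi n)\<^sup>2 * w ^ 4 = inverse w ^ Suc (2 * m + 3)"
          using w(2) unfolding n
          by (simp_all add: field_simps power_add power_mult eval_nat_numeral)
        then show ?thesis using W[OF w] by (simp only: mult.assoc)
      qed
    qed
    with d0 show ?thesis by simp
  next
    case 2
    \<comment> \<open>The exponents \<open>2n+4\<close> and \<open>n+3\<close> are both 2, while
      \<open>n+1\<close> is 0 and joins \<open>d\<^sup>2\<close>.\<close>
    have "(f\<^sup>2 + f * k) * w\<^sup>2 + (f * l * d\<^sup>2 - d\<^sup>2) = 0" if "w \<ge> \<bar>d\<bar>" "w > 0" for w
      using W[OF that] that(2) unfolding 2
      by (simp add: power_int_minus field_simps eval_nat_numeral)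
    from affine_in_square_eq_0[of "\<bar>d\<bar>", OF this]
    have "f * (f + k) = 0" "(f * l - 1) * d\<^sup>2 = 0"
      by (simp_all add: power2_eq_square algebra_simps)
    with f0 d0 have "f = - k" "f * l = 1"
      by auto
    with 2 d' show ?thesis by auto
  next
    case 4
    \<comment> \<open>The exponents \<open>2n+4\<close> and \<open>n+1\<close> are both -2, while
      \<open>n+3\<close> is 0; the identity is multiplied by \<open>w\<^sup>2\<close>.\<close>
    have "(f * k - d\<^sup>2) * w\<^sup>2 + (f\<^sup>2 + f * l * d\<^sup>2) = 0" if "w \<ge> \<bar>d\<bar>" "w > 0" for w
      using W[OF that] that(2) unfolding 4
      by (simp add: power_int_minus field_simps eval_nat_numeral)
    from affine_in_square_eq_0[of "\<bar>d\<bar>", OF this]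
    have fk: "f * k = d\<^sup>2" and "f * (f + l * d\<^sup>2) = 0"
      by (simp_all add: power2_eq_square algebra_simps)
    with f0 have "f = - (l * d\<^sup>2)"
      by (simp add: add_eq_0_iff2)
    with fk have "(k * l + 1) * d\<^sup>2 = 0"
      by algebra
    with d0 have kl: "k * l + 1 = 0" by simp
    \<comment> \<open>So \<open>inverse k\<close> is a true reciprocal and not the default value at
      0.\<close>
    have "k \<noteq> 0" using fk d0 by auto
    then have "f = d\<^sup>2 * inverse k"
      by (simp flip: fk)
    with kl show ?thesis using 4 d' by blast
  next
    case 3
    \<comment> \<open>Multiplied by \<open>w\<close>, the identity is a quadratic polynomial in
      \<open>w\<close>. It vanishes at the three points \<open>p\<close>, \<open>2 * p\<close>,
      \<open>3 * p\<close> below, hence all its coefficients are 0.\<close>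
    have W3: "f * k * w\<^sup>2 + (f\<^sup>2 - d\<^sup>2) * w + f * l * d\<^sup>2 = 0" if "w \<ge> \<bar>d\<bar>" "w > 0" for w
      using W[OF that] that(2) unfolding 3
      by (simp add: power_int_minus field_simps eval_nat_numeral)
    define p q where "p = \<bar>d\<bar>" and "q = f\<^sup>2 - d\<^sup>2"
    have p: "p > 0" using d0 by (simp add: p_def)
    have "f * k * p\<^sup>2 + q * p + f * l * d\<^sup>2 = 0"
      "f * k * (2 * p)\<^sup>2 + q * (2 * p) + f * l * d\<^sup>2 = 0"
      "f * k * (3 * p)\<^sup>2 + q * (3 * p) + f * l * d\<^sup>2 = 0"
      using W3[of p] W3[of "2 * p"] W3[of "3 * p"] p by (simp_all add: p_def q_def)
    moreover have "f * k * (2 * p)\<^sup>2 = 4 * (f * k * p\<^sup>2)" "f * k * (3 * p)\<^sup>2 = 9 * (f * k * p\<^sup>2)"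
      "q * (2 * p) = 2 * (q * p)" "q * (3 * p) = 3 * (q * p)"
      by (simp_all add: power_mult_distrib)
    ultimately have "f * k * p\<^sup>2 = 0" "q * p = 0" "f * l * d\<^sup>2 = 0"
      by linarith+
    then show ?thesis
      using 3 d' f0 d0 p by (simp add: q_def)
  qed
qed

section \<open>Choice of sign and passage to the whole interval\<close>

text \<open>The quotient of \<open>f\<close> by \<open>g\<close> is continuous with values in
  \<open>{1, -1}\<close>, hence constant on a connected set. It makes the sign in the helicoid case
  the same for all \<open>u\<close>.\<close>

lemma continuous_sign_choice:
  fixes f g :: "real \<Rightarrow> real"
  assumes "connected S" "continuous_on S f" "continuous_on S g"
    and "\<And>x. x \<in> S \<Longrightarrow> g x \<noteq> 0" and "\<And>x. x \<in> S \<Longrightarrow> (f x)\<^sup>2 = (g x)\<^sup>2"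
  shows "(\<forall>x\<in>S. f x = g x) \<or> (\<forall>x\<in>S. f x = - g x)"
proof -
  have cont: "continuous_on S (\<lambda>x. f x / g x)"
    using assms by (intro continuous_intros) auto
  have pm: "f x / g x = 1 \<or> f x / g x = -1" if "x \<in> S" for x
    using assms(4,5)[OF that] by (auto simp: power2_eq_iff)
  have "(\<lambda>x. f x / g x) ` S \<subseteq> {1, -1}" using pm by blast
  then have "finite ((\<lambda>x. f x / g x) ` S)" by (rule finite_subset) simp
  with cont assms(1) have "(\<lambda>x. f x / g x) constant_on S"
    using continuous_finite_range_constant by blast
  then obtain c where c: "\<And>x. x \<in> S \<Longrightarrow> f x / g x = c"
    unfolding constant_on_def by blast
  then show ?thesis
    proof (cases "c = 1")
    case True
    then have "f x = g x" if "x \<in> S" for x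
      using c[OF that] assms(4)[OF that] by simp
    then show ?thesis by blast
  next
    case False
    then have "f x = - g x" if "x \<in> S" for x
      using c[OF that] pm[OF that] assms(4)[OF that] by (auto simp: divide_eq_eq)
    then show ?thesis by blast
  qed
qed

theorem proposition1:
  fixes I :: "real set" and s e :: "real \<Rightarrow> real^3"
    and k\<^sub>1 k\<^sub>2 :: "real \<Rightarrow> real \<Rightarrow> real"
    and f :: "real \<Rightarrow> real" and n :: int
  assumes surface: "skew_ruled_surface I s e"
    and curvatures: "principal_curvature_functions (ruled_surface s e) (I \<times> UNIV) k\<^sub>1 k\<^sub>2"
    and f_cont: "continuous_on I f"
    and form: "(\<forall>u\<in>I. \<forall>v. k\<^sub>1 u v = f u * w_fun s e u v powi n) \<or>
               (\<forall>u\<in>I. \<forall>v. k\<^sub>2 u v = f u * w_fun s e u v powi n)"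
  shows "(n = -1 \<and> (\<forall>u\<in>I. f u = - conical_curvature e u) \<and> Edlinger_surface I s e)
       \<or> (n = -2 \<and> ((\<forall>u\<in>I. f u = distribution_parameter s e u) \<or>
                    (\<forall>u\<in>I. f u = - distribution_parameter s e u)) \<and> right_helicoid I s e)
       \<or> (n = -3 \<and> (\<forall>u\<in>I. f u = (distribution_parameter s e u)\<^sup>2 * inverse (conical_curvature e u))
            \<and> Edlinger_surface I s e)"
proof -
  define k d l d' where "k = conical_curvature e" and "d = distribution_parameter s e"
    and "l = cot_striction s e" and "d' = deriv d"
  have I: "is_interval I" "I \<noteq> {}" and d0: "\<And>u. u \<in> I \<Longrightarrow> d u \<noteq> 0"
    using surface unfolding skew_ruled_surface_def d_def by auto
  \<comment> \<open>Both \<open>k\<^sub>1\<close> and \<open>k\<^sub>2\<close> take principal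
    curvatures as values, so the two alternatives of \<open>form\<close> merge here.\<close>
  have pc: "principal_curvature (ruled_surface s e) u v (f u * w_fun s e u v powi n)"
    if "u \<in> I" for u v
  proof -
    have set_eq: "{\<kappa>. principal_curvature (ruled_surface s e) u v \<kappa>} = {k\<^sub>1 u v, k\<^sub>2 u v}"
      using curvatures that unfolding principal_curvature_functions_def by auto
    then have "principal_curvature (ruled_surface s e) u v (k\<^sub>1 u v)"
      "principal_curvature (ruled_surface s e) u v (k\<^sub>2 u v)" by blast+
    then show ?thesis using form that by metis
  qed
  have cases: "d' u = 0 \<and>
      (n = -1 \<and> f u = - k u \<and> k u * l u + 1 = 0 \<or>
       n = -2 \<and> k u = 0 \<and> l u = 0 \<and> (f u)\<^sup>2 = (d u)\<^sup>2 \<or>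
       n = -3 \<and> f u = (d u)\<^sup>2 * inverse (k u) \<and> k u * l u + 1 = 0)" if u: "u \<in> I" for u
    unfolding k_def d_def l_def d'_def
    by (rule characteristic_equation_power_solutions[OF d0[OF u, unfolded d_def]])
      (rule principal_curvature_ruled_surface[OF surface u pc[OF u], unfolded w_fun_def])
  \<comment> \<open>As \<open>n\<close> does not depend on \<open>u\<close>, a single point of
    \<open>I\<close> decides which case holds on all of \<open>I\<close>.\<close>
  consider "n = -1" | "n = -2" | "n = -3" using cases I(2) by blast
  then show ?thesis
  proof cases
    case 1
    then have "\<forall>u\<in>I. d' u = 0 \<and> f u = - k u \<and> k u * l u + 1 = 0"
      using cases by auto
    with 1 surface show ?thesis
      by (simp add: Edlinger_surface_def k_def l_def d_def d'_def)
  next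
    case 2
    have "continuous_on I d"
      unfolding d_def
      by (intro continuous_at_imp_continuous_on ballI has_vector_derivative_continuous)
        (rule distribution_parameter_has_derivative[OF surface])
    then have "(\<forall>u\<in>I. f u = d u) \<or> (\<forall>u\<in>I. f u = - d u)"
      using I(1) f_cont d0 cases 2
      by (intro continuous_sign_choice is_interval_connected) auto
    moreover have "\<forall>u\<in>I. d' u = 0 \<and> k u = 0 \<and> l u = 0"
      using cases 2 by auto
    ultimately show ?thesis
      using 2 surface by (simp add: right_helicoid_def k_def l_def d_def d'_def)
  next
    case 3
    then have "\<forall>u\<in>I. d' u = 0 \<and> f u = (d u)\<^sup>2 * inverse (k u) \<and> k u * l u + 1 = 0"
      using cases by auto
    with 3 surface show ?thesis
      by (simp add: Edlinger_surface_def k_def l_def d_def d'_def)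
  qed
qed

end
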